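(* Let $d\ge 1$, let $N$ and $\ell_1,\ldots,\ell_{d+1}$ be positive integers satisfying $\ell_i\le N$ for all $i$ and $\ell_i+\ell_j\ge N$ for all $i\ne j$. Let $$\mathcal H_{\ell,N}^d=\{\nu\in\mathbb N_0^d:\ \nu_i\le\ell_i,\ 1\le i\le d,\ |\nu|\le N\}.$$ Then the polynomials $\mathsf Q_\nu(\cdot;\ell,N)$ are well defined on $V_{\ell,N}^d$ for every $\nu\in\mathcal H_{\ell,N}^d$. Furthermore, if $\nu\in\mathcal H_{\ell,N}^d\setminus H_{\ell,N}^d$, then $\mathsf Q_\nu(x;\ell,N)=0$ for all $x\in V_{\ell,N}^d$.
   Context: Notation: $(a)_k=a(a+1)\cdots(a+k-1)$, $(a)_0=1$; for a vector, $|\cdot|$ is the sum of its entries, so $|\nu|=\nu_1+\cdots+\nu_d$, $|\ell|=\ell_1+\cdots+\ell_{d+1}$; $|\mathbf x_{j-1}|=x_1+\cdots+x_{j-1}$ (with $|\mathbf x_0|=0$); $|\boldsymbol\nu^{j+1}|=\nu_{j+1}+\cdots+\nu_d$ (with $|\boldsymbol\nu^{d+1}|=0$); $|\boldsymbol\ell^{j+1}|=\ell_{j+1}+\cdots+\ell_{d+1}$. Put $\mathsf a_j=|\boldsymbol\ell^{j+1}|-2|\boldsymbol\nu^{j+1}|$ for $1\le j\le d$. The discrete polyhedral domain is $$V_{\ell,N}^d=\{x\in\mathbb N_0^d:\ 0\le x_i\le\ell_i\ (1\le i\le d),\ N-\ell_{d+1}\le|x|\le N\}.$$ The one-variable Hahn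 polynomials with negative integer parameters are $\mathsf Q_n(t;a,b,M)={}_3F_2\left(\begin{matrix}-n,\,n-a-b-1,\,-t\\-a,\,-M\end{matrix};1\right)=\sum_{k=0}^n\frac{(-n)_k(n-a-b-1)_k(-t)_k}{(-a)_k(-M)_kk!}$. The Hahn polynomials on the polyhedron are $$\mathsf Q_\nu(x;\ell,N)=\prod_{j=1}^d(-N_j)_{\nu_j}\,\mathsf Q_{\nu_j}(x_j;\ell_j,\mathsf a_j,N_j),\qquad N_j:=N-|\mathbf x_{j-1}|-|\boldsymbol\nu^{j+1}|,$$ where each product $(-N_j)_{\nu_j}\mathsf Q_{\nu_j}$ is understood as a polynomial in $x$ after the cancellation $(-N_j)_{\nu_j}/(-N_j)_k=(-N_j+k)_{\nu_j-k}$, i.e. the $j$-th factor is $\sum_{k=0}^{\nu_j}\frac{(-\nu_j)_k(\nu_j-\ell_j-\mathsf a_j-1)_k(-x_j)_k(-N_j+k)_{\nu_j-k}}{(-\ell_j)_k\,k!}$. "Well defined" means that no denominator in this expression vanishes. The index set $H_{\ell,N}^d$ is $$H_{\ell,N}^d=\{\nu\in\mathbb N_0^d:\ |\nu|\le N,\ |\nu|\le|\ell|-N,\ \nu_j\le\ell_j,\ \nu_j\le\mathsf a_j,\ 1\le j\le d\}.$$ *)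

theory Defs
  imports Complex_Main "HOL-Library.FuncSet"
begin

text \<open>
  Vectors \<open>(v\<^sub>1, \<dots>, v\<^sub>m)\<close> are functions on \<open>nat\<close>, read at the indices \<open>1, \<dots>, m\<close>; the parameter
  vector \<open>l\<close> has the \<open>d + 1\<close> entries \<open>l 1, \<dots>, l (d + 1)\<close>. Elements of \<open>\<nat>\<^sub>0\<^sup>d\<close> are extensional
  functions on \<open>{1..d}\<close>. The rising factorial \<open>(a)\<^sub>k\<close> is \<^const>\<open>pochhammer\<close>.
\<close>

definition nat_vecs :: "nat \<Rightarrow> (nat \<Rightarrow> nat) set" where
  "nat_vecs d = {1..d} \<rightarrow>\<^sub>E UNIV"

definition poly_domain :: "nat \<Rightarrow> (nat \<Rightarrow> nat) \<Rightarrow> nat \<Rightarrow> (nat \<Rightarrow> nat) set" where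
  "poly_domain d l N = {x \<in> nat_vecs d. (\<forall>i\<in>{1..d}. x i \<le> l i) \<and>
     int N - int (l (d + 1)) \<le> int (\<Sum>i=1..d. x i) \<and> (\<Sum>i=1..d. x i) \<le> N}"

definition hahn_denom :: "real \<Rightarrow> nat \<Rightarrow> real" where
  "hahn_denom a k = pochhammer (-a) k * fact k"

text \<open>The one-variable Hahn polynomial \<open>Q\<^sub>n(t; a, b, M)\<close> with negative parameters.\<close>

definition hahn1 :: "nat \<Rightarrow> real \<Rightarrow> real \<Rightarrow> real \<Rightarrow> real \<Rightarrow> real" where
  "hahn1 n t a b M = (\<Sum>k=0..n.
     pochhammer (- real n) k * pochhammer (real n - a - b - 1) k * pochhammer (-t) k
       / (pochhammer (-M) k * hahn_denom a k))"

text \<open>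
  The product \<open>(-M)\<^sub>n Q\<^sub>n(t; a, b, M)\<close> after the cancellation
  \<open>(-M)\<^sub>n / (-M)\<^sub>k = (-M + k)\<^sub>n\<^sub>-\<^sub>k\<close>. It is also meaningful when \<open>(-M)\<^sub>k\<close> vanishes; see
  \<open>hahn_factor_eq\<close> for the case where nothing vanishes.
\<close>

definition hahn_factor :: "nat \<Rightarrow> real \<Rightarrow> real \<Rightarrow> real \<Rightarrow> real \<Rightarrow> real" where
  "hahn_factor n t a b M = (\<Sum>k=0..n.
     pochhammer (- real n) k * pochhammer (real n - a - b - 1) k * pochhammer (-t) k
       * pochhammer (-M + real k) (n - k)
       / hahn_denom a k)"

lemma hahn_factor_eq:
  assumes "pochhammer (-M) n \<noteq> 0"
  shows "hahn_factor n t a b M = pochhammer (-M) n * hahn1 n t a b M"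
  unfolding hahn_factor_def hahn1_def sum_distrib_left
proof (rule sum.cong[OF refl])
  fix k assume "k \<in> {0..n}"
  then have *: "pochhammer (-M) n = pochhammer (-M) k * pochhammer (-M + real k) (n - k)"
    by (simp add: pochhammer_product)
  with assms have "pochhammer (-M) k \<noteq> 0"
    by auto
  then show "pochhammer (- real n) k * pochhammer (real n - a - b - 1) k * pochhammer (-t) k
       * pochhammer (-M + real k) (n - k) / hahn_denom a k =
     pochhammer (-M) n * (pochhammer (- real n) k * pochhammer (real n - a - b - 1) k
       * pochhammer (-t) k / (pochhammer (-M) k * hahn_denom a k))"
    by (simp add: *)
qed

text \<open>\<open>a\<^sub>j = (l\<^sub>j\<^sub>+\<^sub>1 + \<dots> + l\<^sub>d\<^sub>+\<^sub>1) - 2 (\<nu>\<^sub>j\<^sub>+\<^sub>1 + \<dots> + \<nu>\<^sub>d)\<close>, which may be negative.\<close>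

definition hahn_a :: "nat \<Rightarrow> (nat \<Rightarrow> nat) \<Rightarrow> (nat \<Rightarrow> nat) \<Rightarrow> nat \<Rightarrow> int" where
  "hahn_a d l \<nu> j = (\<Sum>i=j+1..d+1. int (l i)) - 2 * (\<Sum>i=j+1..d. int (\<nu> i))"

definition hahn_N :: "nat \<Rightarrow> nat \<Rightarrow> (nat \<Rightarrow> nat) \<Rightarrow> (nat \<Rightarrow> real) \<Rightarrow> nat \<Rightarrow> real" where
  "hahn_N d N \<nu> x j = real N - (\<Sum>i=1..<j. x i) - (\<Sum>i=j+1..d. real (\<nu> i))"

definition hahn_poly ::
    "nat \<Rightarrow> (nat \<Rightarrow> nat) \<Rightarrow> nat \<Rightarrow> (nat \<Rightarrow> nat) \<Rightarrow> (nat \<Rightarrow> real) \<Rightarrow> real" where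
  "hahn_poly d l N \<nu> x = (\<Prod>j=1..d.
     hahn_factor (\<nu> j) (x j) (real (l j)) (of_int (hahn_a d l \<nu> j)) (hahn_N d N \<nu> x j))"

text \<open>
  No denominator in the expression defining \<^const>\<open>hahn_poly\<close> vanishes. After the cancellation the
  denominators no longer involve \<open>x\<close> or \<open>N\<close>, hence neither does this condition.
\<close>

definition hahn_well_defined :: "nat \<Rightarrow> (nat \<Rightarrow> nat) \<Rightarrow> (nat \<Rightarrow> nat) \<Rightarrow> bool" where
  "hahn_well_defined d l \<nu> \<longleftrightarrow> (\<forall>j\<in>{1..d}. \<forall>k\<in>{0..\<nu> j}. hahn_denom (real (l j)) k \<noteq> 0)"

text \<open>The index set \<open>H\<close>, with the differences taken in the integers.\<close>

definition H_set :: "nat \<Rightarrow> (nat \<Rightarrow> nat) \<Rightarrow> nat \<Rightarrow> (nat \<Rightarrow> nat) set" where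
  "H_set d l N = {\<nu> \<in> nat_vecs d. (\<Sum>j=1..d. \<nu> j) \<le> N \<and>
     int (\<Sum>j=1..d. \<nu> j) \<le> int (\<Sum>j=1..d+1. l j) - int N \<and>
     (\<forall>j\<in>{1..d}. \<nu> j \<le> l j \<and> int (\<nu> j) \<le> hahn_a d l \<nu> j)}"

text \<open>The larger index set, written with a calligraphic \<open>\<H>\<close>.\<close>

definition calH_set :: "nat \<Rightarrow> (nat \<Rightarrow> nat) \<Rightarrow> nat \<Rightarrow> (nat \<Rightarrow> nat) set" where
  "calH_set d l N = {\<nu> \<in> nat_vecs d. (\<forall>i\<in>{1..d}. \<nu> i \<le> l i) \<and> (\<Sum>i=1..d. \<nu> i) \<le> N}"

end

theory Submission
  imports Defs
begin

text \<open>
  By the transformation of a terminating \<open>3F2\<close> obtained from two applications of Chu--Vandermonde,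
  the \<open>j\<close>-th factor vanishes at an integer point unless \<open>\<nu>\<^sub>j \<le> N\<^sub>j\<close>, \<open>\<nu>\<^sub>j \<le> a\<^sub>j\<close> and
  \<open>\<nu>\<^sub>j \<le> l\<^sub>j + a\<^sub>j - N\<^sub>j\<close>, as long as \<open>x\<^sub>j \<le> l\<^sub>j\<close> and \<open>0 \<le> N\<^sub>j - x\<^sub>j \<le> a\<^sub>j\<close>. This last condition
  holds for \<open>j = d\<close> because \<open>x\<close> lies in the polyhedron, and the first and third inequalities for \<open>j\<close>
  are exactly this condition for \<open>j - 1\<close>. Descending from \<open>j = d\<close> to \<open>j = 1\<close>, a nonzero product
  gives \<open>\<nu>\<^sub>j \<le> a\<^sub>j\<close> for all \<open>j\<close>, and at the end \<open>|\<nu>| \<le> N\<close> and \<open>|\<nu>| \<le> |l| - N\<close>.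
\<close>

section \<open>Chu--Vandermonde and a transformation of terminating 3F2 sums\<close>

text \<open>Chu--Vandermonde without denominators. Reversing
  \<open>pochhammer (D + of_nat m) (p - m)\<close> makes its base \<open>1 - D - of_nat p\<close>,
  free of \<open>m\<close>, up to sign; the binomial theorem for rising factorials then
  applies.\<close>

lemma pochhammer_diff_sum:
  fixes B D :: "'a::field_char_0"
  shows "(\<Sum>m\<le>p. (-1) ^ m * of_nat (p choose m) * pochhammer B m * pochhammer (D + of_nat m) (p - m))
    = pochhammer (D - B) p"
proof -
  have "(-1) ^ m * pochhammer (D + of_nat m) (p - m) = (-1) ^ p * pochhammer (1 - D - of_nat p) (p - m)"
    if "m \<le> p" for m
  proof -
    have "pochhammer (- (D + of_nat p - 1)) (p - m)
        = (-1) ^ (p - m) * pochhammer (D + of_nat p - 1 - of_nat (p - m) + 1) (p - m)"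
      by (rule pochhammer_minus)
    moreover have "D + of_nat p - 1 - of_nat (p - m) + 1 = D + of_nat m"
      using that by (simp add: of_nat_diff)
    moreover have "(-1::'a) ^ p * (-1) ^ (p - m) = (-1) ^ m"
    proof -
      have "(-1::'a) ^ p = (-1) ^ m * (-1) ^ (p - m)"
        using that by (simp flip: power_add)
      then show ?thesis
        by (simp add: mult.assoc flip: power_mult_distrib)
    qed
    ultimately show ?thesis
      by (simp add: algebra_simps)
  qed
  then have "(\<Sum>m\<le>p. (-1) ^ m * of_nat (p choose m) * pochhammer B m * pochhammer (D + of_nat m) (p - m))
    = (\<Sum>m\<le>p. (-1) ^ p * (of_nat (p choose m) * pochhammer B m * pochhammer (1 - D - of_nat p) (p - m)))"
    by (intro sum.cong) (auto simp: algebra_simps)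
  also have "\<dots> = (-1) ^ p * pochhammer (B + (1 - D - of_nat p)) p"
    by (simp add: pochhammer_binomial_sum sum_distrib_left)
  also have "\<dots> = pochhammer (D - B) p"
    using pochhammer_minus[of "B - D" p] by (simp add: algebra_simps)
  finally show ?thesis .
qed

text \<open>
  The transformation of a terminating \<open>3F2(-n, A, B; C, D; 1)\<close>: Chu--Vandermonde expands
  \<open>(A)\<^sub>k / (C)\<^sub>k\<close>, and after exchanging the sums it evaluates the inner one. Multiplying by \<open>(D)\<^sub>n\<close>
  keeps the identity valid for every \<open>D\<close>.
\<close>

lemma hypergeom_3F2_transform:
  fixes A B C D :: "'a::field_char_0"
  assumes C: "\<And>k. k \<le> n \<Longrightarrow> pochhammer C k \<noteq> 0"
  shows "(\<Sum>k\<le>n. pochhammer (- of_nat n) k * pochhammer A k * pochhammer B k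
            * pochhammer (D + of_nat k) (n - k) / (pochhammer C k * fact k))
    = (\<Sum>j\<le>n. of_nat (n choose j) * pochhammer (C - A) j * pochhammer B j
            * pochhammer (D - B) (n - j) / pochhammer C j)" (is "?L = ?R")
proof -
  have bin: "pochhammer (- of_nat n) k / fact k = (-1) ^ k * (of_nat (n choose k) :: 'a)" for k
    by (simp add: binomial_gbinomial gbinomial_pochhammer flip: power_mult_distrib)
  have expand: "pochhammer A k / pochhammer C k
      = (\<Sum>j\<le>k. (-1) ^ j * of_nat (k choose j) * pochhammer (C - A) j / pochhammer C j)"
    if "k \<le> n" for k
  proof -
    have "pochhammer A k / pochhammer C k = (\<Sum>j\<le>k. (-1) ^ j * of_nat (k choose j)
        * pochhammer (C - A) j * pochhammer (C + of_nat j) (k - j)) / pochhammer C k"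
      \<comment> \<open>Taken with \<open>D = C\<close> and \<open>B = C - A\<close>, so that
        \<open>D - B = A\<close>.\<close>
      by (subst pochhammer_diff_sum) simp
    also have "\<dots> = (\<Sum>j\<le>k. (-1) ^ j * of_nat (k choose j) * pochhammer (C - A) j / pochhammer C j)"
      unfolding sum_divide_distrib
    proof (rule sum.cong[OF refl])
      fix j assume "j \<in> {..k}"
      then have "pochhammer C k = pochhammer C j * pochhammer (C + of_nat j) (k - j)"
        by (simp add: pochhammer_product)
      with C[OF that] show "(-1) ^ j * of_nat (k choose j) * pochhammer (C - A) j
          * pochhammer (C + of_nat j) (k - j) / pochhammer C k
        = (-1) ^ j * of_nat (k choose j) * pochhammer (C - A) j / pochhammer C j"
        by auto
    qed
    finally show ?thesis .
  qed
  define g where "g k = pochhammer B k * pochhammer (D + of_nat k) (n - k)" for k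
  have "?L = (\<Sum>k\<le>n. (pochhammer (- of_nat n) k / fact k) * (pochhammer A k / pochhammer C k) * g k)"
    by (intro sum.cong) (auto simp: g_def mult_ac)
  also have "\<dots> = (\<Sum>k\<le>n. \<Sum>j\<le>k. (-1) ^ k * of_nat (n choose k)
      * ((-1) ^ j * of_nat (k choose j) * pochhammer (C - A) j / pochhammer C j) * g k)"
    by (intro sum.cong refl) (simp add: bin expand sum_distrib_left sum_distrib_right)
  also have "\<dots> = (\<Sum>j\<le>n. \<Sum>m\<le>n - j. (-1) ^ (j + m) * of_nat (n choose (j + m))
      * ((-1) ^ j * of_nat ((j + m) choose j) * pochhammer (C - A) j / pochhammer C j) * g (j + m))"
    unfolding sum.Sigma[OF finite_atMost ballI[OF finite_atMost]]
    by (rule sum.reindex_bij_witness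
        [where j = "\<lambda>(k, j). (j, k - j)" and i = "\<lambda>(j, m). (j + m, j)"]) auto
  also have "\<dots> = ?R"
  proof (rule sum.cong[OF refl])
    fix j assume "j \<in> {..n}"
    then have j: "j \<le> n" by simp
    have "(-1) ^ (j + m) * of_nat (n choose (j + m))
        * ((-1) ^ j * of_nat ((j + m) choose j) * pochhammer (C - A) j / pochhammer C j) * g (j + m)
      = of_nat (n choose j) * pochhammer (C - A) j / pochhammer C j * pochhammer B j
        * ((-1) ^ m * of_nat ((n - j) choose m) * pochhammer (B + of_nat j) m
          * pochhammer ((D + of_nat j) + of_nat m) (n - j - m))" (is "?l = ?r") if "m \<le> n - j" for m
    proof -
      have "(n choose (j + m)) * ((j + m) choose j) = (n choose j) * ((n - j) choose m)"
        using choose_mult[of j "j + m" n] j that by simp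
      then have ch: "of_nat (n choose (j + m)) * of_nat ((j + m) choose j)
          = (of_nat (n choose j) * of_nat ((n - j) choose m) :: 'a)"
        by (metis of_nat_mult)
      have sgn: "(-1) ^ (j + m) * (-1) ^ j = ((-1) ^ m :: 'a)"
        by (simp add: power_add mult.commute mult.left_commute flip: power_mult_distrib)
      have "?l = ((-1) ^ (j + m) * (-1) ^ j) * (of_nat (n choose (j + m)) * of_nat ((j + m) choose j))
          * pochhammer (C - A) j / pochhammer C j * g (j + m)"
        by (simp add: mult_ac)
      also have "\<dots> = ?r"
        unfolding sgn ch g_def by (simp add: pochhammer_product' mult_ac add_ac)
      finally show ?thesis .
    qed
    then have "(\<Sum>m\<le>n - j. (-1) ^ (j + m) * of_nat (n choose (j + m))
        * ((-1) ^ j * of_nat ((j + m) choose j) * pochhammer (C - A) j / pochhammer C j) * g (j + m))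
      = of_nat (n choose j) * pochhammer (C - A) j / pochhammer C j * pochhammer B j
        * (\<Sum>m\<le>n - j. (-1) ^ m * of_nat ((n - j) choose m) * pochhammer (B + of_nat j) m
          * pochhammer ((D + of_nat j) + of_nat m) (n - j - m))"
      unfolding sum_distrib_left by (intro sum.cong) auto
    \<comment> \<open>The shifts by \<open>j\<close> cancel in \<open>(D + j) - (B + j)\<close>, so
      the inner sum evaluates to a rising factorial of \<open>D - B\<close>.\<close>
    also have "\<dots> = of_nat (n choose j) * pochhammer (C - A) j * pochhammer B j
            * pochhammer (D - B) (n - j) / pochhammer C j"
      unfolding pochhammer_diff_sum by simp
    finally show "(\<Sum>m\<le>n - j. (-1) ^ (j + m) * of_nat (n choose (j + m))
        * ((-1) ^ j * of_nat ((j + m) choose j) * pochhammer (C - A) j / pochhammer C j) * g (j + m))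
      = of_nat (n choose j) * pochhammer (C - A) j * pochhammer B j
            * pochhammer (D - B) (n - j) / pochhammer C j" .
  qed
  finally show ?thesis .
qed

section \<open>Vanishing of a single factor at integer points\<close>

lemma pochhammer_of_int_eq_0:
  assumes "z \<le> 0" "- z < int k"
  shows "pochhammer (of_int z :: 'a::field_char_0) k = 0"
  unfolding pochhammer_eq_0_iff
proof (intro exI conjI)
  show "nat (- z) < k" using assms by linarith
  show "(of_int z :: 'a) = - of_nat (nat (- z))" using assms by simp
qed

lemma pochhammer_minus_nat_nonzero:
  "k \<le> a \<Longrightarrow> pochhammer (- of_nat a :: 'a::field_char_0) k \<noteq> 0"
  by (auto simp: pochhammer_eq_0_iff)

lemma hahn_factor_transform_t:
  assumes "n \<le> a"
  shows "hahn_factor n t (real a) b M = (\<Sum>j\<le>n. real (n choose j) * pochhammer (b + 1 - real n) j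
      * pochhammer (-t) j * pochhammer (t - M) (n - j) / pochhammer (- real a) j)"
  using hypergeom_3F2_transform[of n "- real a" "real n - real a - b - 1" "-t" "-M"] assms
  by (simp add: hahn_factor_def hahn_denom_def pochhammer_minus_nat_nonzero algebra_simps atLeast0AtMost)

text \<open>The 3F2 is symmetric in its numerator parameters; exchanging \<open>A\<close> and
  \<open>B\<close> gives a second form, in which \<open>a + b - M\<close> becomes visible.\<close>

lemma hahn_factor_transform_n:
  assumes "n \<le> a"
  shows "hahn_factor n t (real a) b M = (\<Sum>j\<le>n. real (n choose j) * pochhammer (t - real a) j
      * pochhammer (real n - real a - b - 1) j * pochhammer (real a + b + 1 - M - real n) (n - j)
      / pochhammer (- real a) j)"
  using hypergeom_3F2_transform[of n "- real a" "-t" "real n - real a - b - 1" "-M"] assms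
  by (simp add: hahn_factor_def hahn_denom_def pochhammer_minus_nat_nonzero algebra_simps atLeast0AtMost)

text \<open>If \<open>n > M\<close>, every term of the defining sum is zero: \<open>(-t)_k\<close>
  vanishes for \<open>k > t\<close>, and \<open>(-M + k)_(n - k)\<close> runs through 0 for
  \<open>k \<le> t \<le> M\<close>.\<close>

lemma hahn_factor_nonzero_imp_le_M:
  fixes t :: nat and M :: int
  assumes "hahn_factor n (real t) a b (of_int M) \<noteq> 0" "int t \<le> M"
  shows "int n \<le> M"
proof (rule ccontr)
  assume "\<not> int n \<le> M"
  have "pochhammer (- real t) k * pochhammer (- of_int M + real k) (n - k) = 0" for k
  proof (cases "t < k")
    case True
    then show ?thesis using pochhammer_of_int_eq_0[of "- int t" k, where 'a = real] by simp
  next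
    case False
    then show ?thesis
      using pochhammer_of_int_eq_0[of "- M + int k" "n - k", where 'a = real]
        \<open>\<not> int n \<le> M\<close> \<open>int t \<le> M\<close> by simp
  qed
  then have "hahn_factor n (real t) a b (of_int M) = 0"
    unfolding hahn_factor_def by (intro sum.neutral) (auto simp: mult.assoc)
  with assms show False by simp
qed

text \<open>If \<open>n > b\<close>, the first transformed sum vanishes termwise:
  \<open>(b + 1 - n)_k\<close> is zero for \<open>k \<ge> n - b\<close>, and for smaller
  \<open>k\<close> the length \<open>n - k\<close> exceeds \<open>b \<ge> M - t\<close>, so
  \<open>(t - M)_(n - k)\<close> is zero.\<close>

lemma hahn_factor_nonzero_imp_le_b:
  fixes t a :: nat and b M :: int
  assumes "hahn_factor n (real t) (real a) (of_int b) (of_int M) \<noteq> 0" "n \<le> a"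
    and "int t \<le> M" "M - int t \<le> b"
  shows "int n \<le> b"
proof (rule ccontr)
  assume n: "\<not> int n \<le> b"
  have "pochhammer (of_int b + 1 - real n) k * pochhammer (real t - of_int M) (n - k) = 0"
    if "k \<le> n" for k
  proof (cases "int n - b \<le> int k")
    case True
    then show ?thesis
      using pochhammer_of_int_eq_0[of "b + 1 - int n" k, where 'a = real] n by simp
  next
    case False
    then show ?thesis
      using pochhammer_of_int_eq_0[of "int t - M" "n - k", where 'a = real] that assms(3,4) by simp
  qed
  then have "hahn_factor n (real t) (real a) (of_int b) (of_int M) = 0"
    unfolding hahn_factor_transform_t[OF \<open>n \<le> a\<close>] by (intro sum.neutral) auto
  with assms show False by simp
qed

text \<open>The same argument on the second transformed sum, split at \<open>k = a - t\<close>; the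
  hypothesis \<open>M - t \<le> b\<close> gives \<open>a - t \<le> a + b - M\<close>.\<close>

lemma hahn_factor_nonzero_imp_le_diff:
  fixes t a :: nat and b M :: int
  assumes "hahn_factor n (real t) (real a) (of_int b) (of_int M) \<noteq> 0" "n \<le> a"
    and "t \<le> a" "M - int t \<le> b"
  shows "int n \<le> int a + b - M"
proof (rule ccontr)
  assume n: "\<not> int n \<le> int a + b - M"
  have "pochhammer (real t - real a) k
      * pochhammer (real a + of_int b + 1 - of_int M - real n) (n - k) = 0"
    if "k \<le> n" for k
  proof (cases "a - t < k")
    case True
    then show ?thesis
      using pochhammer_of_int_eq_0[of "int t - int a" k, where 'a = real] \<open>t \<le> a\<close> by simp
  next
    case False
    then show ?thesis
      using pochhammer_of_int_eq_0[of "int a + b + 1 - M - int n" "n - k", where 'a = real]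
        that assms(3,4) n by simp
  qed
  then have "hahn_factor n (real t) (real a) (of_int b) (of_int M) = 0"
    unfolding hahn_factor_transform_n[OF \<open>n \<le> a\<close>] by (intro sum.neutral) auto
  with assms show False by simp
qed

section \<open>Well-definedness and descent over the factors\<close>

lemma calH_imp_well_defined:
  assumes "\<nu> \<in> calH_set d l N"
  shows "hahn_well_defined d l \<nu>"
  unfolding hahn_well_defined_def
proof (intro ballI)
  fix j k assume "j \<in> {1..d}" "k \<in> {0..\<nu> j}"
  moreover from this assms have "\<nu> j \<le> l j"
    by (simp add: calH_set_def)
  ultimately have "k \<le> l j"
    by simp
  then show "hahn_denom (real (l j)) k \<noteq> 0"
    by (simp add: hahn_denom_def pochhammer_minus_nat_nonzero)
qed

text \<open>For \<open>i \<ge> 1\<close> the two inequalities say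
  \<open>0 \<le> N_i - x_i \<le> a_i\<close>. In this form they also make sense at
  \<open>i = 0\<close>, where they bound the sum of \<open>\<nu>\<close> as in
  \<open>H_set\<close>.\<close>

lemma hahn_poly_nonzero_imp_bounds:
  assumes \<nu>: "\<nu> \<in> calH_set d l N" and x: "x \<in> poly_domain d l N"
    and nz: "hahn_poly d l N \<nu> (\<lambda>i. real (x i)) \<noteq> 0" and "i \<le> d"
  shows "(\<Sum>j=1..i. int (x j)) + (\<Sum>j=i+1..d. int (\<nu> j)) \<le> int N \<and>
    int N - (\<Sum>j=1..i. int (x j)) + (\<Sum>j=i+1..d. int (\<nu> j)) \<le> (\<Sum>j=i+1..d+1. int (l j)) \<and>
    (\<forall>j\<in>{i+1..d}. int (\<nu> j) \<le> hahn_a d l \<nu> j)"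
  using \<open>i \<le> d\<close>
proof (induction i rule: inc_induct)
  \<comment> \<open>At \<open>i = d\<close> the sums over \<open>\<nu>\<close> are empty, leaving
    the bounds on the sum of \<open>x\<close> in \<open>poly_domain\<close>.\<close>
  case base
  from x show ?case
    by (auto simp: poly_domain_def simp flip: of_nat_sum)
next
  case (step i)
  let ?j = "Suc i"
  define X where "X = (\<Sum>j=1..i. int (x j))"
  define U where "U = (\<Sum>j=Suc i+1..d. int (\<nu> j))"
  define L where "L = (\<Sum>j=Suc i+1..d+1. int (l j))"
  define M where "M = int N - X - U"
  have j: "?j \<in> {1..d}" using step.hyps by simp
  have X': "(\<Sum>j=1..?j. int (x j)) = X + int (x ?j)"
    by (simp add: X_def)
  have U': "(\<Sum>j=i+1..d. int (\<nu> j)) = int (\<nu> ?j) + U"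
    using step.hyps by (simp add: U_def sum.atLeast_Suc_atMost)
  have L': "(\<Sum>j=i+1..d+1. int (l j)) = int (l ?j) + L"
    using step.hyps unfolding L_def by (subst sum.atLeast_Suc_atMost) auto
  have a: "hahn_a d l \<nu> ?j = L - 2 * U"
    by (simp add: hahn_a_def L_def U_def)
  have M: "hahn_N d N \<nu> (\<lambda>i. real (x i)) ?j = of_int M"
    by (simp add: hahn_N_def M_def X_def U_def atLeastLessThanSuc_atLeastAtMost)
  have le: "\<nu> ?j \<le> l ?j" "x ?j \<le> l ?j"
    using \<nu> x j by (auto simp: calH_set_def poly_domain_def)
  from step.IH have IH: "X + int (x ?j) + U \<le> int N" "int N - (X + int (x ?j)) + U \<le> L"
    "\<forall>j\<in>{Suc i+1..d}. int (\<nu> j) \<le> hahn_a d l \<nu> j"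
    unfolding X' U_def L_def by blast+
  have dom: "int (x ?j) \<le> M" "M - int (x ?j) \<le> hahn_a d l \<nu> ?j"
    using IH by (simp_all add: M_def a)
  have F: "hahn_factor (\<nu> ?j) (real (x ?j)) (real (l ?j)) (of_int (hahn_a d l \<nu> ?j)) (of_int M) \<noteq> 0"
    using nz j unfolding hahn_poly_def M[symmetric] by (simp add: prod_zero_iff)
  have "int (\<nu> ?j) \<le> M"
    using hahn_factor_nonzero_imp_le_M[OF F dom(1)] .
  moreover have "int (\<nu> ?j) \<le> hahn_a d l \<nu> ?j"
    using hahn_factor_nonzero_imp_le_b[OF F le(1) dom] .
  moreover have "int (\<nu> ?j) \<le> int (l ?j) + hahn_a d l \<nu> ?j - M"
    using hahn_factor_nonzero_imp_le_diff[OF F le dom(2)] .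
  moreover have "{i+1..d} = insert ?j {Suc i+1..d}"
    using step.hyps by auto
  ultimately have "\<forall>j\<in>{i+1..d}. int (\<nu> j) \<le> hahn_a d l \<nu> j"
    using IH(3) by simp
  \<comment> \<open>With \<open>M = N - X - U\<close> and \<open>a_j = L - 2 * U\<close>, these two
    bounds rearrange to the two inequalities at \<open>i\<close>.\<close>
  with \<open>int (\<nu> ?j) \<le> M\<close> \<open>int (\<nu> ?j) \<le> int (l ?j) + hahn_a d l \<nu> ?j - M\<close> show ?case
    unfolding U' L' X_def[symmetric] by (simp add: M_def a)
qed

lemma hahn_poly_nonzero_imp_H:
  assumes \<nu>: "\<nu> \<in> calH_set d l N" and x: "x \<in> poly_domain d l N"
    and nz: "hahn_poly d l N \<nu> (\<lambda>i. real (x i)) \<noteq> 0"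
  shows "\<nu> \<in> H_set d l N"
  using hahn_poly_nonzero_imp_bounds[OF assms, of 0] \<nu>
  by (simp add: H_set_def calH_set_def)

theorem theorem3p6:
  fixes d N :: nat and l :: "nat \<Rightarrow> nat"
  assumes "d \<ge> 1" and "N > 0"
    and "\<forall>i\<in>{1..d+1}. l i > 0"
    and "\<forall>i\<in>{1..d+1}. l i \<le> N"
    and "\<forall>i\<in>{1..d+1}. \<forall>j\<in>{1..d+1}. i \<noteq> j \<longrightarrow> l i + l j \<ge> N"
  shows "(\<forall>\<nu>\<in>calH_set d l N. hahn_well_defined d l \<nu>) \<and>
    (\<forall>\<nu>\<in>calH_set d l N - H_set d l N. \<forall>x\<in>poly_domain d l N.
       hahn_poly d l N \<nu> (\<lambda>i. real (x i)) = 0)"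
  using calH_imp_well_defined hahn_poly_nonzero_imp_H by blast

end
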